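(* Let $q,c\in\mathbb{C}$ be constants with $q\neq 0$, and consider the equation $$w'(z)^{2}+w(qz+c)^{2}=1 .$$ According to the different values of $q$, the following hold. (1) If $q\neq \pm 1$, then the equation does not possess any transcendental entire solution of finite order. (2) If $q=1$, then the equation has the finite-order transcendental entire solution $$w(z)=\sin(z+B),$$ where $B$ is a constant and $c=k\pi$ ($k\in\mathbb{Z}$). (3) If $q=-1$, then the equation has the finite-order transcendental entire solution $$w(z)=\sin(z+B),$$ where $B$ is a constant and $2B+c=k\pi$ ($k\in\mathbb{Z}$).
   Context: The order of a meromorphic (in particular entire) function $w$ is $\rho(w)=\limsup_{r\to\infty}\frac{\log^{+}T(r,w)}{\log r}$, where $T(r,w)$ is the Nevanlinna characteristic function. A function is of finite order if $\rho(w)<\infty$. An entire function is transcendental if it is not a polynomial. *)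

theory Defs
  imports "HOL-Complex_Analysis.Complex_Analysis"
begin

section \<open>Nevanlinna characteristic and order of growth\<close>

definition log_pos :: "real \<Rightarrow> real" where
  "log_pos x = ln (max 1 x)"

definition proximity_fun :: "(complex \<Rightarrow> complex) \<Rightarrow> real \<Rightarrow> real" where
  "proximity_fun f r =
     1 / (2 * pi) * integral {0..2 * pi} (\<lambda>t. log_pos (norm (f (of_real r * cis t))))"

text \<open>The order of a pole \<open>z\<close> of \<open>f\<close> is \<open>- zorder f z\<close>.\<close>

definition pole_count :: "(complex \<Rightarrow> complex) \<Rightarrow> real \<Rightarrow> nat" where
  "pole_count f t = (\<Sum>z \<in> {z \<in> cball 0 t. is_pole f z}. nat (- zorder f z))"

definition integrated_pole_count :: "(complex \<Rightarrow> complex) \<Rightarrow> real \<Rightarrow> real" where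
  "integrated_pole_count f r =
     integral {0..r} (\<lambda>t. (real (pole_count f t) - real (pole_count f 0)) / t)
     + real (pole_count f 0) * ln r"

definition nevanlinna_char :: "(complex \<Rightarrow> complex) \<Rightarrow> real \<Rightarrow> real" where
  "nevanlinna_char f r = proximity_fun f r + integrated_pole_count f r"

definition growth_order :: "(complex \<Rightarrow> complex) \<Rightarrow> ereal" where
  "growth_order f = Limsup at_top (\<lambda>r. ereal (log_pos (nevanlinna_char f r) / ln r))"

definition finite_order :: "(complex \<Rightarrow> complex) \<Rightarrow> bool" where
  "finite_order f \<longleftrightarrow> growth_order f < \<infinity>"

section \<open>Transcendental entire solutions\<close>

definition transcendental_entire :: "(complex \<Rightarrow> complex) \<Rightarrow> bool" where
  "transcendental_entire f \<longleftrightarrow> f holomorphic_on UNIV \<and> \<not> (\<exists>p. \<forall>z. f z = poly p z)"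

definition solves_equation :: "complex \<Rightarrow> complex \<Rightarrow> (complex \<Rightarrow> complex) \<Rightarrow> bool" where
  "solves_equation q c w \<longleftrightarrow> (\<forall>z. (deriv w z)\<^sup>2 + (w (q * z + c))\<^sup>2 = 1)"

definition finite_order_solution :: "complex \<Rightarrow> complex \<Rightarrow> (complex \<Rightarrow> complex) \<Rightarrow> bool" where
  "finite_order_solution q c w \<longleftrightarrow>
     transcendental_entire w \<and> finite_order w \<and> solves_equation q c w"

end

theory Submission
  imports Defs
begin

text \<open>
  Factoring the left-hand side as \<open>(w'(z) + \<i> w(q z + c)) (w'(z) - \<i> w(q z + c)) = 1\<close> gives an
  entire \<open>H\<close> with \<open>w = sin H\<close> and \<open>w'(z) = cos (H(q z + c))\<close>. Since \<open>\<bar>Im H\<bar>\<close> is bounded by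
  \<open>log\<^sup>+ \<bar>w\<bar> + ln 3\<close>, finite order bounds the circular means of \<open>\<bar>Im H\<bar>\<close> polynomially, and these
  means dominate the Taylor coefficients of \<open>H\<close>; so \<open>H\<close> is a polynomial. Comparing the two
  expressions for \<open>w'\<close>, \<open>H' cos H = cos (H(q z + c))\<close> is a relation between exponentials of
  polynomials with polynomial coefficients, which by a version of Borel's theorem forces
  \<open>H(q z + c) = \<plusminus>H(z) + d\<close> and \<open>H' = \<plusminus>1\<close>, hence \<open>q = \<plusminus>1\<close> and \<open>w(z) = sin (z + B)\<close>. The condition
  on \<open>c\<close> is then read off at the zero \<open>z = -B\<close> of \<open>w\<close>.
\<close>

section \<open>Linear independence of exponentials of polynomials\<close>

text \<open>For \<open>p \<noteq> 0\<close> the equation makes the degree of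
  \<open>pderiv p = - (p * pderiv G)\<close> at least that of \<open>p\<close>, whereas
  differentiation lowers the degree.\<close>

lemma first_order_linear_poly_eq_0:
  fixes p G :: "complex poly"
  assumes "pderiv p + p * pderiv G = 0" and "degree G \<noteq> 0"
  shows "p = 0"
proof (rule ccontr)
  assume p: "p \<noteq> 0"
  have G: "pderiv G \<noteq> 0"
    using assms(2) by (simp add: pderiv_eq_0_iff)
  have eq: "pderiv p = - (p * pderiv G)"
    using assms(1) by (simp add: add_eq_0_iff2)
  have "degree (pderiv p) \<ge> degree p"
    using p G by (simp add: eq degree_mult_eq)
  moreover have "pderiv p \<noteq> 0"
    using p G by (simp add: eq)
  ultimately show False
    by (simp add: degree_pderiv pderiv_eq_0_iff)
qed

text \<open>
  Dividing by one of the exponentials and differentiating lowers the degree of its coefficient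
  until the term disappears, while by the previous lemma no other coefficient can vanish on the way.
\<close>

lemma exp_polys_linear_independent:
  fixes p g :: "'i \<Rightarrow> complex poly"
  assumes "finite I"
    and "\<And>i j. i \<in> I \<Longrightarrow> j \<in> I \<Longrightarrow> i \<noteq> j \<Longrightarrow> degree (g i - g j) \<noteq> 0"
    and "\<And>z. (\<Sum>i\<in>I. poly (p i) z * exp (poly (g i) z)) = 0"
    and "i \<in> I"
  shows "p i = 0"
  using assms
proof (induction I arbitrary: p i rule: finite_induct)
  case empty
  then show ?case by simp
next
  case (insert k I)
  \<comment> \<open>Inner induction on a number \<open>n\<close> of derivatives that annihilates
    \<open>p k\<close>, for all families \<open>p\<close> at once because the family changes at each
    step. At \<open>n = 0\<close> the term \<open>k\<close> drops out and the outer hypothesis for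
    \<open>I\<close> applies.\<close>
  have "\<forall>i\<in>insert k I. p i = 0"
    if "(pderiv ^^ n) (p k) = 0"
      and "\<And>z. (\<Sum>i\<in>insert k I. poly (p i) z * exp (poly (g i) z)) = 0" for n p
    using that
  proof (induction n arbitrary: p)
    case 0
    then have "p k = 0" by simp
    with 0(2) insert.hyps have "(\<Sum>i\<in>I. poly (p i) z * exp (poly (g i) z)) = 0" for z
      by simp
    with insert.IH[of p] insert.prems(1) have "p i = 0" if "i \<in> I" for i
      using that by blast
    with \<open>p k = 0\<close> show ?case by blast
  next
    case (Suc n)
    \<comment> \<open>Coefficients of the derivative of the relation divided by
      \<open>exp (poly (g k) z)\<close>.\<close>
    define p' where "p' i = pderiv (p i) + p i * pderiv (g i - g k)" for i
    have p'k: "p' k = pderiv (p k)"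
      by (simp add: p'_def)
    have "(\<Sum>i\<in>insert k I. poly (p' i) z * exp (poly (g i) z)) = 0" for z
    proof -
      define F where "F z = (\<Sum>i\<in>insert k I. poly (p i) z * exp (poly (g i - g k) z))" for z
      have "F = (\<lambda>z. 0)"
      proof
        fix z
        have "F z = exp (- poly (g k) z) * (\<Sum>i\<in>insert k I. poly (p i) z * exp (poly (g i) z))"
          unfolding F_def sum_distrib_left
          by (intro sum.cong refl) (simp add: exp_diff exp_minus divide_inverse)
        then show "F z = 0"
          using Suc.prems(2) by simp
      qed
      moreover have "(F has_field_derivative
          (\<Sum>i\<in>insert k I. poly (p' i) z * exp (poly (g i - g k) z))) (at z)"
        unfolding F_def p'_def
        by (rule DERIV_sum) (auto intro!: derivative_eq_intros simp: algebra_simps pderiv_diff)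
      ultimately have "(\<Sum>i\<in>insert k I. poly (p' i) z * exp (poly (g i - g k) z)) = 0"
        using DERIV_unique DERIV_const by blast
      moreover have "(\<Sum>i\<in>insert k I. poly (p' i) z * exp (poly (g i) z)) =
          exp (poly (g k) z) * (\<Sum>i\<in>insert k I. poly (p' i) z * exp (poly (g i - g k) z))"
        unfolding sum_distrib_left
        by (intro sum.cong refl) (simp add: exp_diff)
      ultimately show ?thesis by simp
    qed
    moreover have "(pderiv ^^ n) (p' k) = 0"
      using Suc.prems(1) by (simp add: p'k funpow_Suc_right del: funpow.simps)
    ultimately have p'0: "\<forall>i\<in>insert k I. p' i = 0"
      using Suc.IH by blast
    have pI: "p i = 0" if "i \<in> I" for i
    proof (rule first_order_linear_poly_eq_0)
      show "pderiv (p i) + p i * pderiv (g i - g k) = 0"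
        using p'0 that by (auto simp: p'_def)
      show "degree (g i - g k) \<noteq> 0"
        using insert.hyps(2) insert.prems(1) that by blast
    qed
    \<comment> \<open>From \<open>p' k = 0\<close> it only follows that \<open>p k\<close> is
      constant, so its vanishing is taken from the original relation, where it is now the only term
      left.\<close>
    have "poly (p k) z = 0" for z
      using Suc.prems(2)[of z] insert.hyps pI by simp
    then have "p k = 0"
      using poly_all_0_iff_0 by blast
    with pI show ?case by blast
  qed
  moreover have "(pderiv ^^ Suc (degree (p k))) (p k) = 0"
    by (rule poly_eqI) (simp add: coeff_higher_pderiv coeff_eq_0 del: funpow.simps)
  ultimately show ?case
    using insert.prems(2,3) by blast
qed

section \<open>Entire functions: logarithms and Taylor coefficients\<close>

text \<open>The factor \<open>u + \<i> * v\<close> has inverse \<open>u - \<i> * v\<close>, hence no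
  zeros, hence an entire logarithm \<open>g\<close> because the plane is contractible. Euler's
  formulas give \<open>h = - \<i> * g\<close>.\<close>

lemma holomorphic_cos_sin_param:
  assumes "u holomorphic_on UNIV" and "v holomorphic_on UNIV"
    and eq: "\<And>z::complex. (u z)\<^sup>2 + (v z)\<^sup>2 = (1::complex)"
  obtains h where "h holomorphic_on UNIV" "\<And>z. u z = cos (h z)" "\<And>z. v z = sin (h z)"
proof -
  define f where "f z = u z + \<i> * v z" for z
  have prod: "f z * (u z - \<i> * v z) = 1" for z
    using eq[of z] by (simp add: f_def algebra_simps power2_eq_square)
  have "f holomorphic_on UNIV"
    unfolding f_def[abs_def] by (intro holomorphic_intros assms)
  moreover have "f z \<noteq> 0" for z
    using prod[of z] by auto
  ultimately obtain g where g: "g holomorphic_on UNIV" "\<And>z. z \<in> UNIV \<Longrightarrow> f z = exp (g z)"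
    using contractible_imp_holomorphic_log[OF _ contractible_UNIV] by blast
  have plus: "exp (g z) = u z + \<i> * v z" for z
    using g(2)[of z] by (simp add: f_def)
  have minus: "exp (- g z) = u z - \<i> * v z" for z
    using prod[of z] g(2)[of z] by (simp add: exp_minus inverse_unique)
  show ?thesis
  proof
    show "(\<lambda>z. - \<i> * g z) holomorphic_on UNIV"
      by (intro holomorphic_intros g)
    show "u z = cos (- \<i> * g z)" "v z = sin (- \<i> * g z)" for z
      by (simp_all add: cos_exp_eq sin_exp_eq plus minus)
  qed
qed

text \<open>
  Besides the Cauchy formula for the \<open>n\<close>-th coefficient, the negative-index Fourier coefficient of
  \<open>f\<close> vanishes; conjugating it and subtracting replaces \<open>f\<close> by \<open>f - cnj f = 2 \<i> Im f\<close>.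
\<close>

lemma taylor_coeff_le_mean_Im:
  assumes f: "f holomorphic_on UNIV" and r: "r > 0" and n: "n \<ge> 1"
  shows "norm ((deriv ^^ n) f 0 / fact n) * r ^ n
    \<le> 1 / pi * integral {0..2 * pi} (\<lambda>t. \<bar>Im (f (of_real r * cis t))\<bar>)"
proof -
  define a where "a = (deriv ^^ n) f 0 / fact n"
  have contf: "continuous_on A f" for A
    using f holomorphic_on_imp_continuous_on continuous_on_subset by blast
  have holf: "f holomorphic_on A" for A
    using f holomorphic_on_subset by blast
  have "((\<lambda>u. f u / (u - 0) ^ Suc n) has_contour_integral 2 * pi * \<i> * a) (circlepath 0 r)"
    using Cauchy_has_contour_integral_higher_derivative_circlepath[OF contf holf, of 0 0 r n] r
    by (simp add: a_def)
  then have "((\<lambda>t. f (r * cis t) / (r * cis t) ^ Suc n * r * \<i> * cis t)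
      has_integral 2 * pi * \<i> * a) {0..2 * pi}"
    by (simp add: circlepath_def has_contour_integral_part_circlepath_iff)
  \<comment> \<open>The factor \<open>r ^ n / \<i>\<close> turns Cauchy's integrand into that of a
    Fourier coefficient of \<open>f\<close> on the circle.\<close>
  then have "((\<lambda>t. (r ^ n / \<i>) * (f (r * cis t) / (r * cis t) ^ Suc n * r * \<i> * cis t))
      has_integral (r ^ n / \<i>) * (2 * pi * \<i> * a)) {0..2 * pi}"
    by (rule has_integral_mult_right)
  moreover have "(r ^ n / \<i>) * (f (r * cis t) / (r * cis t) ^ Suc n * r * \<i> * cis t) =
      f (r * cis t) * cis (- (n * t))" for t :: real
  proof -
    have "cis (n * t) * cis (- (n * t)) = 1"
      by (simp add: cis_mult)
    then show ?thesis
      using r by (simp add: field_simps power_mult_distrib Complex.DeMoivre)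
  qed
  ultimately have neg: "((\<lambda>t. f (r * cis t) * cis (- (n * t))) has_integral 2 * pi * a * r ^ n) {0..2 * pi}"
    by (simp add: mult_ac)
  \<comment> \<open>Cauchy's theorem for an entire integrand. Since \<open>n \<ge> 1\<close>, the
    exponent \<open>n - 1\<close> is not truncated, and the factor \<open>cis t\<close> from the
    parametrisation completes the power to \<open>n\<close>.\<close>
  have "((\<lambda>u. f u * u ^ (n - 1)) has_contour_integral 0) (circlepath 0 r)"
    using r by (intro Cauchy_theorem_disc_simple[of _ 0 "r + 1"] holomorphic_intros holf)
      (auto simp: dist_norm)
  then have "((\<lambda>t. f (r * cis t) * (r * cis t) ^ (n - 1) * r * \<i> * cis t) has_integral 0) {0..2 * pi}"
    by (simp add: circlepath_def has_contour_integral_part_circlepath_iff)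
  then have "((\<lambda>t. (1 / (r ^ n * \<i>)) * (f (r * cis t) * (r * cis t) ^ (n - 1) * r * \<i> * cis t))
      has_integral (1 / (r ^ n * \<i>)) * 0) {0..2 * pi}"
    by (rule has_integral_mult_right)
  moreover have "(1 / (r ^ n * \<i>)) * (f (r * cis t) * (r * cis t) ^ (n - 1) * r * \<i> * cis t) =
      f (r * cis t) * cis (n * t)" for t :: real
  proof -
    have "(r * cis t) ^ (n - 1) * (r * cis t) = (r * cis t) ^ n"
      using n by (simp flip: power_Suc2)
    then have *: "f (r * cis t) * (r * cis t) ^ (n - 1) * r * \<i> * cis t =
        f (r * cis t) * \<i> * (r * cis t) ^ n"
      by (simp add: mult_ac)
    show ?thesis
      unfolding * using r by (simp add: power_mult_distrib Complex.DeMoivre)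
  qed
  ultimately have "((\<lambda>t. f (r * cis t) * cis (n * t)) has_integral 0) {0..2 * pi}"
    by simp
  then have "((\<lambda>t. cnj (f (r * cis t) * cis (n * t))) has_integral cnj 0) {0..2 * pi}"
    by (subst (asm) has_integral_cnj[symmetric]) (simp add: o_def)
  then have "((\<lambda>t. cnj (f (r * cis t)) * cis (- (n * t))) has_integral 0) {0..2 * pi}"
    by (simp add: cis_cnj)
  from has_integral_diff[OF neg this]
  have "((\<lambda>t. (f (r * cis t) - cnj (f (r * cis t))) * cis (- (n * t)))
      has_integral 2 * pi * a * r ^ n) {0..2 * pi}"
    by (simp add: left_diff_distrib)
  then have int: "((\<lambda>t. 2 * \<i> * Im (f (r * cis t)) * cis (- (n * t))) has_integral 2 * pi * a * r ^ n) {0..2 * pi}"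
    by (simp add: complex_diff_cnj mult_ac)
  have cont: "continuous_on {0..2 * pi} (\<lambda>t. 2 * \<bar>Im (f (r * cis t))\<bar>)"
    by (intro continuous_intros continuous_on_compose2[OF contf[of UNIV]]) auto
  have "norm (2 * pi * a * r ^ n) \<le> integral {0..2 * pi} (\<lambda>t. 2 * \<bar>Im (f (r * cis t))\<bar>)"
    unfolding integral_unique[OF int, symmetric]
    by (rule integral_norm_bound_integral)
      (use int integrable_continuous_real[OF cont] in \<open>auto simp: norm_mult simp del: integrable_on_cmult_iff\<close>)
  then show ?thesis
    using r by (simp add: a_def[symmetric] norm_mult norm_power field_simps)
qed

lemma entire_eq_poly:
  assumes "f holomorphic_on UNIV" and "\<And>n. n \<ge> N \<Longrightarrow> (deriv ^^ n) f 0 = 0"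
  obtains p where "\<And>z::complex. f z = poly p z"
proof
  define p where "p = (\<Sum>n<N. monom ((deriv ^^ n) f 0 / fact n) n)"
  fix z
  have "(\<lambda>n. (deriv ^^ n) f 0 / fact n * (z - 0) ^ n) sums f z"
    using assms(1) by (intro holomorphic_power_series[of _ _ "norm z + 1"])
      (auto intro: holomorphic_on_subset)
  moreover have "(\<lambda>n. (deriv ^^ n) f 0 / fact n * (z - 0) ^ n) sums
      (\<Sum>n<N. (deriv ^^ n) f 0 / fact n * (z - 0) ^ n)"
    using assms(2) by (intro sums_finite) auto
  ultimately show "f z = poly p z"
    by (simp add: p_def poly_sum poly_monom sums_unique2)
qed

section \<open>From finite order of the sine to a polynomial argument\<close>

text \<open>The exponentials in \<open>sin z\<close> have moduli \<open>exp (Im z)\<close> and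
  \<open>exp (- Im z)\<close>, so \<open>exp \<bar>Im z\<bar> \<le> 1 + 2 * norm (sin z)\<close>.
  The right side is at most three times \<open>max 1 (norm (sin z))\<close>, whence
  \<open>ln 3\<close>.\<close>

lemma abs_Im_le_log_pos_sin: "\<bar>Im z\<bar> \<le> log_pos (norm (sin z)) + ln 3"
proof -
  have sin: "2 * norm (sin z) = norm (exp (\<i> * z) - exp (- (\<i> * z)))"
    by (simp add: sin_exp_eq norm_divide norm_mult)
  have "exp \<bar>Im z\<bar> - exp (- \<bar>Im z\<bar>) \<le> 2 * norm (sin z)"
  proof (cases "Im z \<ge> 0")
    case True
    then show ?thesis
      using norm_triangle_ineq2[of "exp (- (\<i> * z))" "exp (\<i> * z)"]
      by (simp add: sin norm_minus_commute)
  next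
    case False
    then show ?thesis
      using norm_triangle_ineq2[of "exp (\<i> * z)" "exp (- (\<i> * z))"]
      by (simp add: sin)
  qed
  moreover have "exp (- \<bar>Im z\<bar>) \<le> 1"
    by simp
  ultimately have "exp \<bar>Im z\<bar> \<le> max 1 (norm (sin z)) * 3"
    by linarith
  then have "ln (exp \<bar>Im z\<bar>) \<le> ln (max 1 (norm (sin z)) * 3)"
    by (subst ln_le_cancel_iff) auto
  also have "\<dots> = ln (max 1 (norm (sin z))) + ln 3"
    by (simp add: ln_mult)
  finally show ?thesis
    by (simp add: log_pos_def)
qed

lemma nevanlinna_char_entire:
  assumes "f holomorphic_on UNIV"
  shows "nevanlinna_char f r = proximity_fun f r"
proof -
  have "\<not> is_pole f z" for z
    using assms not_is_pole_holomorphic[of UNIV] by auto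
  then have "pole_count f t = 0" for t
    by (simp add: pole_count_def)
  then show ?thesis
    by (simp add: nevanlinna_char_def integrated_pole_count_def)
qed

text \<open>Any natural \<open>N\<close> above the order works: for \<open>r > 1\<close> the
  denominator \<open>ln r\<close> is positive and can be cleared.\<close>

lemma finite_order_imp_nevanlinna_char_le:
  assumes "finite_order f"
  obtains N :: nat where "eventually (\<lambda>r. nevanlinna_char f r \<le> r ^ N) at_top"
proof -
  from assms obtain N :: nat where "growth_order f < ereal N"
    unfolding finite_order_def using less_PInf_Ex_of_nat by auto
  then have "eventually (\<lambda>r. ereal (log_pos (nevanlinna_char f r) / ln r) < ereal N) at_top"
    unfolding growth_order_def by (rule Limsup_lessD)
  then have "eventually (\<lambda>r. nevanlinna_char f r \<le> r ^ N) at_top"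
    using eventually_gt_at_top[of 1]
  proof eventually_elim
    case (elim r)
    then have "ln (max 1 (nevanlinna_char f r)) < ln (r ^ N)"
      by (simp add: log_pos_def divide_less_eq ln_realpow)
    with elim(2) have "max 1 (nevanlinna_char f r) < r ^ N"
      by (subst (asm) ln_less_cancel_iff) auto
    then show ?case by simp
  qed
  then show ?thesis by (rule that)
qed

text \<open>The means of \<open>\<bar>Im h\<bar>\<close> are \<open>O(r ^ N)\<close> and bound the
  \<open>n\<close>-th Taylor coefficient times \<open>r ^ n\<close>. Letting \<open>r\<close> grow
  kills every coefficient with \<open>n > N\<close>.\<close>

lemma finite_order_sin_imp_poly:
  assumes h: "h holomorphic_on UNIV" and fin: "finite_order (\<lambda>z. sin (h z))"
  obtains p where "\<And>z::complex. h z = poly p z"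
proof -
  let ?w = "\<lambda>z. sin (h z)"
  have conth: "continuous_on UNIV h"
    using h holomorphic_on_imp_continuous_on by blast
  have "?w holomorphic_on UNIV"
    using h by (intro holomorphic_intros)
  note T = nevanlinna_char_entire[OF this]
  obtain N :: nat where N: "eventually (\<lambda>r. proximity_fun ?w r \<le> r ^ N) at_top"
    using finite_order_imp_nevanlinna_char_le[OF fin] unfolding T by blast
  \<comment> \<open>The factor 2 compares the normalisation \<open>1 / pi\<close> of the coefficient
    bound with \<open>1 / (2 * pi)\<close> in \<open>proximity_fun\<close>.\<close>
  have mean: "1 / pi * integral {0..2 * pi} (\<lambda>t. \<bar>Im (h (of_real r * cis t))\<bar>)
      \<le> 2 * proximity_fun ?w r + 2 * ln 3" for r
  proof -
    have 1: "continuous_on {0..2 * pi} (\<lambda>t. \<bar>Im (h (of_real r * cis t))\<bar>)"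
      by (intro continuous_intros continuous_on_compose2[OF conth]) auto
    have 2: "continuous_on {0..2 * pi} (\<lambda>t. log_pos (norm (?w (of_real r * cis t))))"
      unfolding log_pos_def
      by (intro continuous_intros continuous_on_compose2[OF conth]) (auto simp: max_def)
    have "integral {0..2 * pi} (\<lambda>t. \<bar>Im (h (of_real r * cis t))\<bar>) \<le>
        integral {0..2 * pi} (\<lambda>t. log_pos (norm (?w (of_real r * cis t))) + ln 3)"
      by (intro integral_le integrable_continuous_real 1 continuous_on_add 2 continuous_on_const
          abs_Im_le_log_pos_sin)
    also have "\<dots> = integral {0..2 * pi} (\<lambda>t. log_pos (norm (?w (of_real r * cis t)))) + 2 * pi * ln 3"
      by (subst integral_add) (auto intro: integrable_continuous_real 2)
    finally show ?thesis
      by (simp add: proximity_fun_def field_simps)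
  qed
  have "(deriv ^^ n) h 0 = 0" if n: "n \<ge> Suc N" for n
  proof (rule ccontr)
    define a where "a = norm ((deriv ^^ n) h 0 / fact n)"
    assume "(deriv ^^ n) h 0 \<noteq> 0"
    then have "a > 0" by (simp add: a_def)
    \<comment> \<open>The constant 6 is 2 + 4: for \<open>r \<ge> 1\<close>,
      \<open>2 * ln 3 \<le> 4 \<le> 4 * r ^ N\<close>. The bound reached below is
      \<open>a * r \<le> 6\<close>.\<close>
    have "eventually (\<lambda>r. proximity_fun ?w r \<le> r ^ N \<and> r \<ge> 1 \<and> r > 6 / a) at_top"
      using N eventually_ge_at_top[of 1] eventually_gt_at_top[of "6 / a"]
      by eventually_elim auto
    then obtain r where r: "proximity_fun ?w r \<le> r ^ N" "r \<ge> 1" "r > 6 / a"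
      using eventually_happens'[OF trivial_limit_at_top_linorder] by blast
    have "a * r ^ Suc N \<le> a * r ^ n"
      using \<open>a > 0\<close> r n by (intro mult_left_mono power_increasing) auto
    also have "\<dots> \<le> 2 * proximity_fun ?w r + 2 * ln 3"
      using taylor_coeff_le_mean_Im[OF h, of r n] mean[of r] r n by (simp add: a_def)
    also have "\<dots> \<le> 6 * r ^ N"
      using r(1) one_le_power[OF r(2), of N] ln_le_minus_one[of 3] by linarith
    finally have "a * r \<le> 6"
      using r(2) by (simp add: mult_ac)
    with r(3) \<open>a > 0\<close> show False
      by (simp add: field_simps)
  qed
  with entire_eq_poly[OF h] that show ?thesis by blast
qed

section \<open>Identities between cosines of polynomials\<close>

text \<open>Comparing coefficients of \<open>exp (\<i> * P)\<close> and
  \<open>exp (- \<i> * P)\<close> gives \<open>A = exp (\<i> * d)\<close> and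
  \<open>A = exp (- \<i> * d)\<close>. These two numbers have product 1, so \<open>A\<close> squares
  to 1.\<close>

lemma cos_poly_shift_identity:
  fixes A P :: "complex poly"
  assumes eq: "\<And>z. poly A z * cos (poly P z) = cos (poly P z + d)" and P: "degree P \<noteq> 0"
  obtains e where "e \<in> {1, -1}" "A = [:e:]"
proof -
  define p g where "p = (\<lambda>b. if b then A - [:exp (\<i> * d):] else A - [:exp (- (\<i> * d)):])"
    and "g = (\<lambda>b. if b then smult \<i> P else smult (- \<i>) P)"
  have "smult \<i> P - smult (- \<i>) P = smult (2 * \<i>) P" "smult (- \<i>) P - smult \<i> P = smult (- 2 * \<i>) P"
    unfolding poly_eq_iff coeff_diff coeff_add coeff_smult by (simp_all add: algebra_simps)
  then have deg: "degree (g i - g j) \<noteq> 0" if "i \<noteq> j" for i j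
    using that P by (cases i; cases j) (auto simp: g_def)
  have sum: "(\<Sum>b\<in>UNIV. poly (p b) z * exp (poly (g b) z)) = 0" for z
  proof -
    have "exp (\<i> * (poly P z + d)) = exp (\<i> * poly P z) * exp (\<i> * d)"
      "exp (- (\<i> * (poly P z + d))) = exp (- (\<i> * poly P z)) * exp (- (\<i> * d))"
      by (simp_all add: distrib_left flip: exp_add)
    then have "poly A z * (exp (\<i> * poly P z) + exp (- (\<i> * poly P z))) =
        exp (\<i> * poly P z) * exp (\<i> * d) + exp (- (\<i> * poly P z)) * exp (- (\<i> * d))"
      using eq[of z] unfolding cos_exp_eq by simp
    then show ?thesis
      by (simp add: UNIV_bool p_def g_def algebra_simps)
  qed
  have "p b = 0" for b
    by (rule exp_polys_linear_independent[of UNIV g p]) (use deg sum in auto)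
  from this[of True] this[of False]
  have A: "A = [:exp (\<i> * d):]" "A = [:exp (- (\<i> * d)):]"
    by (simp_all add: p_def)
  have "exp (\<i> * d) * exp (- (\<i> * d)) = 1"
    by (simp flip: exp_add)
  with A have "exp (\<i> * d) * exp (\<i> * d) = 1"
    by simp
  then have "exp (\<i> * d) \<in> {1, -1}"
    by (simp add: square_eq_1_iff)
  with A that show ?thesis by blast
qed

text \<open>If neither \<open>Q - P\<close> nor \<open>Q + P\<close> were constant, the exponents
  \<open>\<i> * P\<close>, \<open>- \<i> * P\<close>, \<open>\<i> * Q\<close>,
  \<open>- \<i> * Q\<close> would differ pairwise by non-constants, and independence would force the
  coefficient -1 of \<open>exp (\<i> * Q)\<close> to vanish. Otherwise the shifted case
  applies.\<close>

lemma cos_poly_identity: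
  fixes A P Q :: "complex poly"
  assumes eq: "\<And>z. poly A z * cos (poly P z) = cos (poly Q z)"
    and P: "degree P \<noteq> 0" and Q: "degree Q \<noteq> 0"
  obtains e s d where "e \<in> {1, -1}" "s \<in> {1, -1}" "A = [:e:]" "Q = smult s P + [:d:]"
proof -
  have "degree (Q - P) = 0 \<or> degree (Q + P) = 0"
  proof (rule ccontr)
    assume neg: "\<not> ?thesis"
    define p g where "p = (!) [A, A, - 1, - 1]"
      and "g = (!) [smult \<i> P, smult (- \<i>) P, smult \<i> Q, smult (- \<i>) Q]"
    have I: "{..<4::nat} = {0, 1, 2, 3}" by auto
    \<comment> \<open>Each difference is written as a nonzero multiple of \<open>P\<close>,
      \<open>Q\<close>, \<open>Q - P\<close> or \<open>Q + P\<close>, so that its degree can be read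
      off.\<close>
    have "smult \<i> P - smult (- \<i>) P = smult (2 * \<i>) P" "smult (- \<i>) P - smult \<i> P = smult (- 2 * \<i>) P"
      "smult \<i> Q - smult (- \<i>) Q = smult (2 * \<i>) Q" "smult (- \<i>) Q - smult \<i> Q = smult (- 2 * \<i>) Q"
      "smult \<i> P - smult \<i> Q = smult (- \<i>) (Q - P)" "smult \<i> Q - smult \<i> P = smult \<i> (Q - P)"
      "smult (- \<i>) P - smult (- \<i>) Q = smult \<i> (Q - P)"
      "smult (- \<i>) Q - smult (- \<i>) P = smult (- \<i>) (Q - P)"
      "smult \<i> P - smult (- \<i>) Q = smult \<i> (Q + P)" "smult (- \<i>) Q - smult \<i> P = smult (- \<i>) (Q + P)"
      "smult (- \<i>) P - smult \<i> Q = smult (- \<i>) (Q + P)" "smult \<i> Q - smult (- \<i>) P = smult \<i> (Q + P)"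
      unfolding poly_eq_iff coeff_diff coeff_add coeff_smult by (simp_all add: algebra_simps)
    then have deg: "degree (g i - g j) \<noteq> 0" if "i \<in> {..<4}" "j \<in> {..<4}" "i \<noteq> j" for i j
      using that P Q neg unfolding I by (auto simp: g_def)
    have sum: "(\<Sum>i<4. poly (p i) z * exp (poly (g i) z)) = 0" for z
    proof -
      have "poly A z * (exp (\<i> * poly P z) + exp (- (\<i> * poly P z))) =
          exp (\<i> * poly Q z) + exp (- (\<i> * poly Q z))"
        using eq[of z] unfolding cos_exp_eq by simp
      then show ?thesis
        unfolding I by (simp add: p_def g_def algebra_simps)
    qed
    have "p 2 = 0"
      by (rule exp_polys_linear_independent[of "{..<4}" g p]) (use deg sum in auto)
    then show False
      by (simp add: p_def)
  qed
  then show ?thesis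
  proof
    assume "degree (Q - P) = 0"
    then obtain d where "Q - P = [:d:]"
      by (rule degree_eq_zeroE)
    then have Qd: "Q = smult 1 P + [:d:]"
      by (simp add: algebra_simps)
    have "poly A z * cos (poly P z) = cos (poly P z + d)" for z
      using eq[of z] by (simp add: Qd)
    then obtain e where "e \<in> {1, -1}" "A = [:e:]"
      by (rule cos_poly_shift_identity[OF _ P])
    with Qd show ?thesis
      by (intro that[of e "1" d]) auto
  next
    assume "degree (Q + P) = 0"
    then obtain d where "Q + P = [:d:]"
      by (rule degree_eq_zeroE)
    then have Qd: "Q = smult (- 1) P + [:d:]"
      by (simp add: algebra_simps)
    \<comment> \<open>The case \<open>Q = - P + d\<close> reduces to a shift by \<open>- d\<close>
      because cosine is even.\<close>
    have "poly A z * cos (poly P z) = cos (poly P z + (- d))" for z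
    proof -
      have "poly Q z = - (poly P z + (- d))"
        by (simp add: Qd)
      then show ?thesis
        using eq[of z] by (simp only: cos_minus)
    qed
    then obtain e where "e \<in> {1, -1}" "A = [:e:]"
      by (rule cos_poly_shift_identity[OF _ P])
    with Qd show ?thesis
      by (intro that[of e "- 1" d]) auto
  qed
qed

section \<open>The shape of finite-order solutions\<close>

lemma finite_order_solution_imp_sin:
  assumes "q \<noteq> 0" and sol: "finite_order_solution q c w"
  obtains B where "q \<in> {1, -1}" "\<And>z. w z = sin (z + B)"
proof -
  have w: "w holomorphic_on UNIV" and npoly: "\<And>p. \<exists>z. w z \<noteq> poly p z" and fin: "finite_order w"
    and eq: "\<And>z. (deriv w z)\<^sup>2 + (w (q * z + c))\<^sup>2 = 1"
    using sol by (auto simp: finite_order_solution_def transcendental_entire_def solves_equation_def)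
  have "deriv w holomorphic_on UNIV"
    using w by (intro holomorphic_deriv) auto
  moreover have "(w \<circ> (\<lambda>z. q * z + c)) holomorphic_on UNIV"
    by (intro holomorphic_on_compose holomorphic_intros holomorphic_on_subset[OF w]) auto
  ultimately obtain h where h: "h holomorphic_on UNIV"
      and cosh: "\<And>z. deriv w z = cos (h z)" and sinh: "\<And>z. w (q * z + c) = sin (h z)"
    using holomorphic_cos_sin_param[of "deriv w" "w \<circ> (\<lambda>z. q * z + c)"] eq by auto
  \<comment> \<open>Undoing the affine substitution turns \<open>w (q * z + c) = sin (h z)\<close>
    into \<open>w = sin H\<close>, and then \<open>deriv w z = cos (H (q * z + c))\<close>.\<close>
  define H where "H = h \<circ> (\<lambda>z. (z - c) / q)"
  have H: "H holomorphic_on UNIV"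
    unfolding H_def using \<open>q \<noteq> 0\<close>
    by (intro holomorphic_on_compose holomorphic_intros holomorphic_on_subset[OF h]) auto
  have wH: "w = (\<lambda>z. sin (H z))"
  proof
    fix z show "w z = sin (H z)"
      using sinh[of "(z - c) / q"] \<open>q \<noteq> 0\<close> by (simp add: H_def)
  qed
  obtain P where P: "\<And>z. H z = poly P z"
    using finite_order_sin_imp_poly[OF H] fin unfolding wH by blast
  define Q where "Q = pcompose P [:c, q:]"
  have degP: "degree P \<noteq> 0"
  proof
    assume "degree P = 0"
    then obtain a where "P = [:a:]"
      by (rule degree_eq_zeroE)
    then have "w z = poly [:sin a:] z" for z
      by (simp add: wH P)
    with npoly show False by blast
  qed
  have degQ: "degree Q \<noteq> 0"
    using degP \<open>q \<noteq> 0\<close> by (simp add: Q_def degree_pcompose)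
  have "poly (pderiv P) z * cos (poly P z) = cos (poly Q z)" for z
  proof -
    have "(w has_field_derivative poly (pderiv P) z * cos (poly P z)) (at z)"
      unfolding wH P by (auto intro!: derivative_eq_intros)
    then have "poly (pderiv P) z * cos (poly P z) = deriv w z"
      by (simp add: DERIV_imp_deriv)
    also have "\<dots> = cos (H (q * z + c))"
      using \<open>q \<noteq> 0\<close> by (simp add: cosh H_def)
    also have "H (q * z + c) = poly Q z"
      by (simp add: P Q_def poly_pcompose algebra_simps)
    finally show ?thesis .
  qed
  then obtain e s d where e: "e \<in> {1, -1}" and s: "s \<in> {1, -1}"
      and dP: "pderiv P = [:e:]" and Qs: "Q = smult s P + [:d:]"
    by (rule cos_poly_identity[OF _ degP degQ])
  \<comment> \<open>Both sides are the derivative of \<open>Q\<close>, once as \<open>P\<close>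
    composed with \<open>q * z + c\<close> and once as \<open>s * P + d\<close>. Cancelling
    \<open>e\<close> leaves \<open>q = s\<close>.\<close>
  have "[:e * q:] = [:s * e:]"
    using arg_cong[OF Qs, of pderiv] unfolding Q_def pderiv_pcompose dP pderiv_add pderiv_smult
    by (simp add: pderiv_pCons mult_ac)
  with e s have q: "q \<in> {1, -1}"
    by auto
  define b where "b = coeff P 0"
  have "pderiv (P - [:b, e:]) = 0"
    by (simp add: pderiv_diff dP pderiv_pCons)
  then obtain b' where b': "P - [:b, e:] = [:b':]"
    unfolding pderiv_eq_0_iff by (rule degree_eq_zeroE)
  have "w z = sin (e * z + (b + b'))" for z
    using arg_cong[OF b', of "\<lambda>p. poly p z"] by (simp add: wH P algebra_simps)
  \<comment> \<open>For \<open>e = - 1\<close>, the reflection \<open>sin (pi - x) = sin x\<close>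
    restores the coefficient 1 of \<open>z\<close>.\<close>
  then have "w z = sin (z + (if e = 1 then b + b' else pi - (b + b')))" for z
  proof (cases "e = 1")
    case False
    with e have "e = - 1" by auto
    moreover have "sin (z + (pi - (b + b'))) = sin (- z + (b + b'))"
      by (simp add: sin_diff cos_diff sin_add cos_add algebra_simps)
    ultimately show ?thesis
      using \<open>\<And>z. w z = sin (e * z + (b + b'))\<close> by simp
  qed simp
  with q that show ?thesis by blast
qed

section \<open>Transcendence and finite order of the shifted sine\<close>

text \<open>A polynomial vanishing at all points \<open>n * pi - B\<close> is zero, but the value at
  \<open>pi / 2 - B\<close> is 1.\<close>

lemma transcendental_entire_sin_shift: "transcendental_entire (\<lambda>z. sin (z + B))"
  unfolding transcendental_entire_def
proof (intro conjI notI)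
  show "(\<lambda>z. sin (z + B)) holomorphic_on UNIV"
    by (intro holomorphic_intros)
  assume "\<exists>p. \<forall>z. sin (z + B) = poly p z"
  then obtain p where p: "\<And>z. sin (z + B) = poly p z"
    by blast
  have "poly p (of_int n * complex_of_real pi - B) = 0" for n
    unfolding p[symmetric] by (auto simp: sin_eq_0)
  then have "range (\<lambda>n::int. of_int n * complex_of_real pi - B) \<subseteq> {z. poly p z = 0}"
    by blast
  moreover have "infinite (range (\<lambda>n::int. of_int n * complex_of_real pi - B))"
    by (subst finite_image_iff) (auto intro!: injI simp: infinite_UNIV_int)
  ultimately have "p = 0"
    using poly_roots_finite[of p] finite_subset by metis
  with p[of "complex_of_real (pi / 2) - B"] sin_of_real[of "pi / 2", where 'a = complex] show False
    by (simp del: of_real_divide)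
qed

lemma norm_sin_le_exp_norm: "norm (sin z) \<le> exp (norm z)" for z :: complex
proof -
  have "2 * norm (sin z) = norm (exp (\<i> * z) - exp (- (\<i> * z)))"
    by (simp add: sin_exp_eq norm_divide norm_mult)
  also have "\<dots> \<le> norm (exp (\<i> * z)) + norm (exp (- (\<i> * z)))"
    by (rule norm_triangle_ineq4)
  also have "\<dots> \<le> exp (norm z) + exp (norm z)"
    by (intro add_mono order.trans[OF norm_exp]) (simp_all add: norm_mult)
  finally show ?thesis by simp
qed

lemma finite_order_sin_shift: "finite_order (\<lambda>z. sin (z + B))"
proof -
  let ?w = "\<lambda>z. sin (z + B)"
  have T: "nevanlinna_char ?w r \<le> r + norm B" if "r \<ge> 0" for r
  proof -
    have le: "log_pos (norm (?w (of_real r * cis t))) \<le> r + norm B" for t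
    proof -
      have "norm (?w (of_real r * cis t)) \<le> exp (norm (of_real r * cis t + B))"
        by (rule norm_sin_le_exp_norm)
      also have "norm (of_real r * cis t + B) \<le> r + norm B"
        using norm_triangle_ineq[of "of_real r * cis t" B] that by (simp add: norm_mult)
      finally have "max 1 (norm (?w (of_real r * cis t))) \<le> exp (r + norm B)"
        using that by simp
      then have "ln (max 1 (norm (?w (of_real r * cis t)))) \<le> ln (exp (r + norm B))"
        by (subst ln_le_cancel_iff) auto
      then show ?thesis
        by (simp add: log_pos_def)
    qed
    have "continuous_on {0..2 * pi} (\<lambda>t. log_pos (norm (?w (of_real r * cis t))))"
      unfolding log_pos_def by (intro continuous_intros) (auto simp: max_def)
    then have "integral {0..2 * pi} (\<lambda>t. log_pos (norm (?w (of_real r * cis t))))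
        \<le> integral {0..2 * pi} (\<lambda>t. r + norm B)"
      by (intro integral_le integrable_continuous_real le continuous_on_const)
    then have "proximity_fun ?w r \<le> 1 / (2 * pi) * (2 * pi * (r + norm B))"
      unfolding proximity_fun_def by (intro mult_left_mono) auto
    moreover have "nevanlinna_char ?w r = proximity_fun ?w r"
      by (intro nevanlinna_char_entire holomorphic_intros)
    ultimately show ?thesis
      by simp
  qed
  \<comment> \<open>For \<open>r \<ge> max 2 (norm B)\<close> the characteristic is at most
    \<open>2 * r \<le> r ^ 2\<close>, so the quotient of logarithms is at most 2.\<close>
  have "eventually (\<lambda>r. ereal (log_pos (nevanlinna_char ?w r) / ln r) \<le> 2) at_top"
    using eventually_ge_at_top[of "max 2 (norm B)"]
  proof eventually_elim
    case (elim r)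
    then have "nevanlinna_char ?w r \<le> 2 * r"
      using T[of r] by simp
    also have "2 * r \<le> r ^ 2"
      using elim by (simp add: power2_eq_square)
    finally have "max 1 (nevanlinna_char ?w r) \<le> r ^ 2"
      using elim by simp
    then have "ln (max 1 (nevanlinna_char ?w r)) \<le> ln (r ^ 2)"
      by (subst ln_le_cancel_iff) (use elim in auto)
    then show ?case
      using elim by (simp add: log_pos_def ln_realpow divide_le_eq)
  qed
  then have "growth_order ?w \<le> 2"
    unfolding growth_order_def by (rule Limsup_bounded)
  then show ?thesis
    unfolding finite_order_def by (rule le_less_trans) simp
qed

section \<open>Which shifted sines solve the equation\<close>

lemma solves_equation_sin_shift_iff:
  "solves_equation q c (\<lambda>z. sin (z + B)) \<longleftrightarrow> (\<forall>z. (sin (q * z + c + B))\<^sup>2 = (sin (z + B))\<^sup>2)"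
proof -
  have "deriv (\<lambda>z. sin (z + B)) z = cos (z + B)" for z
    by (rule DERIV_imp_deriv) (auto intro!: derivative_eq_intros)
  moreover have "(cos (z + B))\<^sup>2 + x = 1 \<longleftrightarrow> x = (sin (z + B))\<^sup>2" for x z
    by (auto simp: cos_squared_eq)
  ultimately show ?thesis
    by (simp add: solves_equation_def)
qed

text \<open>At a zero \<open>a\<close> of sine the cosine is 1 or -1, so adding \<open>a\<close>
  changes \<open>sin z\<close> at most by a sign.\<close>

lemma sin_sq_add_eq:
  fixes a z :: complex
  assumes "sin a = 0"
  shows "(sin (z + a))\<^sup>2 = (sin z)\<^sup>2"
proof -
  have "(cos a)\<^sup>2 = 1"
    using assms by (simp add: cos_squared_eq)
  with assms show ?thesis
    by (simp add: sin_add power_mult_distrib)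
qed

lemma finite_order_solution_sin_shift_iff:
  "finite_order_solution q c (\<lambda>z. sin (z + B)) \<longleftrightarrow>
    (\<forall>z. (sin (q * z + c + B))\<^sup>2 = (sin (z + B))\<^sup>2)"
  by (simp add: finite_order_solution_def transcendental_entire_sin_shift finite_order_sin_shift
      solves_equation_sin_shift_iff)

lemma finite_order_solution_1_sin_shift_iff:
  "finite_order_solution 1 c (\<lambda>z. sin (z + B)) \<longleftrightarrow> (\<exists>k::int. c = of_int k * of_real pi)"
proof -
  have "(\<forall>z. (sin (1 * z + c + B))\<^sup>2 = (sin (z + B))\<^sup>2) \<longleftrightarrow> sin c = 0"
  proof
    assume "\<forall>z. (sin (1 * z + c + B))\<^sup>2 = (sin (z + B))\<^sup>2"
    from this[rule_format, of "- B"] show "sin c = 0" by simp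
  next
    assume "sin c = 0"
    then show "\<forall>z. (sin (1 * z + c + B))\<^sup>2 = (sin (z + B))\<^sup>2"
      using sin_sq_add_eq[of c "z + B" for z] by (simp add: add_ac)
  qed
  then show ?thesis
    by (simp add: finite_order_solution_sin_shift_iff sin_eq_0)
qed

lemma finite_order_solution_minus_1_sin_shift_iff:
  "finite_order_solution (- 1) c (\<lambda>z. sin (z + B)) \<longleftrightarrow>
    (\<exists>k::int. 2 * B + c = of_int k * of_real pi)"
proof -
  have "(\<forall>z. (sin (- 1 * z + c + B))\<^sup>2 = (sin (z + B))\<^sup>2) \<longleftrightarrow> sin (2 * B + c) = 0"
  proof
    assume "\<forall>z. (sin (- 1 * z + c + B))\<^sup>2 = (sin (z + B))\<^sup>2"
    from this[rule_format, of "- B"] show "sin (2 * B + c) = 0" by (simp add: algebra_simps)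
  next
    assume sin: "sin (2 * B + c) = 0"
    show "\<forall>z. (sin (- 1 * z + c + B))\<^sup>2 = (sin (z + B))\<^sup>2"
    proof
      fix z
      \<comment> \<open>The argument is \<open>- (z + B) + (2 * B + c)\<close>: a reflection
        followed by a shift by a zero of sine.\<close>
      show "(sin (- 1 * z + c + B))\<^sup>2 = (sin (z + B))\<^sup>2"
        using sin_sq_add_eq[OF sin, of "- (z + B)"] sin_minus[of "z + B"]
        by (simp add: algebra_simps)
    qed
  qed
  then show ?thesis
    by (simp add: finite_order_solution_sin_shift_iff sin_eq_0)
qed

text \<open>For \<open>q = 1\<close> and \<open>q = -1\<close> the equivalences give both the
  existence of the stated solutions and the fact that there are no others of finite order.\<close>

theorem theorem2p2:
  fixes q c :: complex
  assumes "q \<noteq> 0"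
  shows "(q \<noteq> 1 \<and> q \<noteq> -1 \<longrightarrow> \<not> (\<exists>w. finite_order_solution q c w)) \<and>
    (q = 1 \<longrightarrow> (\<forall>w. finite_order_solution q c w \<longleftrightarrow>
       (\<exists>B. (\<forall>z. w z = sin (z + B)) \<and> (\<exists>k::int. c = of_int k * of_real pi)))) \<and>
    (q = -1 \<longrightarrow> (\<forall>w. finite_order_solution q c w \<longleftrightarrow>
       (\<exists>B. (\<forall>z. w z = sin (z + B)) \<and> (\<exists>k::int. 2 * B + c = of_int k * of_real pi))))"
proof -
  have sol: "\<exists>B. q \<in> {1, -1} \<and> w = (\<lambda>z. sin (z + B))" if "finite_order_solution q c w" for w
    using finite_order_solution_imp_sin[OF assms that] by (metis ext)
  have eqw: "(\<forall>z. w z = sin (z + B)) \<longleftrightarrow> w = (\<lambda>z. sin (z + B))" for w and B :: complex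
    by (simp add: fun_eq_iff)
  show ?thesis
  proof (intro conjI impI allI)
    assume "q \<noteq> 1 \<and> q \<noteq> -1"
    with sol show "\<not> (\<exists>w. finite_order_solution q c w)" by blast
  next
    fix w assume q: "q = 1"
    show "finite_order_solution q c w \<longleftrightarrow>
       (\<exists>B. (\<forall>z. w z = sin (z + B)) \<and> (\<exists>k::int. c = of_int k * of_real pi))"
      using sol[of w] finite_order_solution_1_sin_shift_iff[of c] unfolding q eqw by blast
  next
    fix w assume q: "q = -1"
    show "finite_order_solution q c w \<longleftrightarrow>
       (\<exists>B. (\<forall>z. w z = sin (z + B)) \<and> (\<exists>k::int. 2 * B + c = of_int k * of_real pi))"
      using sol[of w] finite_order_solution_minus_1_sin_shift_iff[of c] unfolding q eqw by blast
  qed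
qed

end
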